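(* Let $n\ge 1$ be an integer and let $1\le p<\infty$. Then for all $f\in C_0^\infty(\mathbb{R}^n)$, $$\int_{\mathbb{R}^n}|(\mathbf{x}\cdot\nabla)f(\mathbf{x})|^p\,d\mathbf{x}\ \ge\ \left(\frac{n}{p}\right)^p\int_{\mathbb{R}^n}|f(\mathbf{x})|^p\,d\mathbf{x}.$$
   Context: $C_0^\infty(\mathbb{R}^n)$ denotes the smooth, compactly supported, complex-valued functions on $\mathbb{R}^n$, and $(\mathbf{x}\cdot\nabla)f=\sum_{j=1}^n x_j\,\partial f/\partial x_j$. *)

theory Defs
  imports "HOL-Analysis.Analysis"
begin

definition partial_deriv ::
    "'n::finite \<Rightarrow> (real ^ 'n \<Rightarrow> complex) \<Rightarrow> real ^ 'n \<Rightarrow> complex" where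
  "partial_deriv j f x = vector_derivative (\<lambda>t::real. f (x + t *\<^sub>R axis j 1)) (at 0)"

(* Because vector_derivative is total, Frechet differentiability is required at each step, so that
   every iterated partial derivative that occurs exists.  Since continuous partial derivatives
   imply differentiability, this is the usual class of k times continuously differentiable
   functions. *)
primrec Ck_function :: "nat \<Rightarrow> (real ^ 'n::finite \<Rightarrow> complex) \<Rightarrow> bool" where
  "Ck_function 0 f \<longleftrightarrow> continuous_on UNIV f"
| "Ck_function (Suc k) f \<longleftrightarrow>
     (\<forall>x. f differentiable (at x)) \<and> (\<forall>j. Ck_function k (partial_deriv j f))"

definition smooth_compact_support :: "(real ^ 'n::finite \<Rightarrow> complex) set" where
  "smooth_compact_support =
     {f. (\<forall>k. Ck_function k f) \<and> compact (closure (support_on UNIV f))}"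

definition x_dot_grad :: "(real ^ 'n::finite \<Rightarrow> complex) \<Rightarrow> real ^ 'n \<Rightarrow> complex" where
  "x_dot_grad f x = (\<Sum>j\<in>UNIV. of_real (x $ j) * partial_deriv j f x)"

end

theory Submission
  imports Defs
begin

text \<open>
  The operator \<open>x \<cdot> \<nabla>\<close> generates the dilations: it is the derivative of \<open>c \<mapsto> f (c x)\<close> at \<open>c = 1\<close>.
  Dilating by \<open>c > 1\<close> multiplies the \<open>L\<^sup>p\<close> norm of a function on \<open>\<real>\<^sup>n\<close> by exactly \<open>c\<close> to the power
  \<open>-n/p\<close>, so by the triangle inequality in \<open>L\<^sup>p\<close> the function \<open>f (c x) - f x\<close> has norm at least
  \<open>1 - c powr (-n/p)\<close> times the norm of \<open>f\<close> (\<open>dilation_difference_lower_bound\<close>). Dividing by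
  \<open>c - 1\<close> and letting \<open>c\<close> tend to 1, the difference quotient becomes \<open>(x \<cdot> \<nabla>) f\<close> and the factor
  becomes \<open>n/p\<close>, which is the claim raised to the power \<open>1/p\<close>
  (\<open>radial_derivative_lower_bound\<close>).

  The limit goes under the integral by dominated convergence: a differentiable function with
  continuous partial derivatives and compact support is globally Lipschitz, so all the difference
  quotients are bounded by \<open>B |x|\<close> on one fixed ball and vanish outside it. Integrating by parts
  instead would require differentiating \<open>|f|\<^sup>p\<close>, which may fail to be smooth at the zeros of \<open>f\<close>;
  dilations avoid this.
\<close>

section \<open>Weighted convexity in place of Minkowski's inequality\<close>

text \<open>
  Convexity of \<open>u powr p\<close> at \<open>a + b = (1 - t) (a / (1 - t)) + t (b / t)\<close>. Integrated over functions
  \<open>a\<close> and \<open>b\<close>, and with \<open>t\<close> chosen according to their norms, this pointwise bound gives Minkowski's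
  inequality; keeping \<open>t\<close> free makes it possible to insert the value that suits dilations.
\<close>

lemma norm_add_powr_le:
  fixes a b :: "'a::real_normed_vector" and p t :: real
  assumes "1 \<le> p" "0 < t" "t < 1"
  shows "norm (a + b) powr p \<le> (1 - t) powr (1 - p) * norm a powr p + t powr (1 - p) * norm b powr p"
proof -
  have one_le: "1 \<le> s powr (1 - p)" if "0 < s" "s < 1" for s :: real
    using powr_mono'[of "1 - p" 0 s] assms that by simp
  have scale: "s * (u / s) powr p = s powr (1 - p) * u powr p" if "0 < s" "0 \<le> u" for s u :: real
    using that by (simp add: powr_divide powr_diff)
  \<comment> \<open>Convexity is available on the open half-line only, so vanishing \<open>a\<close> or \<open>b\<close> are treated apart.\<close>
  consider "a = 0" | "b = 0" | "a \<noteq> 0" "b \<noteq> 0" by blast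
  then show ?thesis
  proof cases
    case 1
    then show ?thesis using one_le[of t] assms mult_right_mono[of 1 "t powr (1 - p)" "norm b powr p"] by simp
  next
    case 2
    then show ?thesis using one_le[of "1 - t"] assms mult_right_mono[of 1 "(1 - t) powr (1 - p)" "norm a powr p"]
      by simp
  next
    case 3
    have "norm (a + b) powr p \<le> (norm a + norm b) powr p"
      using assms by (intro powr_mono2 norm_triangle_ineq) auto
    also have "norm a + norm b = (1 - t) *\<^sub>R (norm a / (1 - t)) + t *\<^sub>R (norm b / t)"
      using assms by simp
    also have "\<dots> powr p \<le> (1 - t) * (norm a / (1 - t)) powr p + t * (norm b / t) powr p"
      using assms 3 by (intro convex_onD[OF powr_convex]) auto
    also have "\<dots> = (1 - t) powr (1 - p) * norm a powr p + t powr (1 - p) * norm b powr p"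
      using assms by (simp only: scale diff_gt_0_iff_gt norm_ge_zero)
    finally show ?thesis .
  qed
qed

section \<open>Dilations\<close>

lemma lborel_dilation:
  fixes g :: "'a::euclidean_space \<Rightarrow> real" and c :: real
  assumes "0 < c" "integrable lborel g"
  shows integrable_lborel_dilation: "integrable lborel (\<lambda>x. g (c *\<^sub>R x))"
    and integral_lborel_dilation:
      "(LINT x|lborel. g (c *\<^sub>R x)) = (LINT x|lborel. g x) / c ^ DIM('a)"
proof -
  have [measurable]: "g \<in> borel_measurable borel"
    using assms by auto
  have lb: "lborel = density (distr lborel borel (\<lambda>x::'a. c *\<^sub>R x)) (\<lambda>_. ennreal (c ^ DIM('a)))"
    using lborel_affine[of c "0::'a"] assms by simp
  have "integrable (density (distr lborel borel (\<lambda>x::'a. c *\<^sub>R x)) (\<lambda>_. ennreal (c ^ DIM('a)))) g"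
    using assms lb by simp
  then show "integrable lborel (\<lambda>x. g (c *\<^sub>R x))"
    using assms by (simp add: integrable_density integrable_distr_eq)
  have "(LINT x|lborel. g x) = (LINT x|density (distr lborel borel (\<lambda>x::'a. c *\<^sub>R x)) (\<lambda>_. ennreal (c ^ DIM('a))). g x)"
    using lb by simp
  also have "\<dots> = c ^ DIM('a) * (LINT x|lborel. g (c *\<^sub>R x))"
    using assms by (simp add: integral_density integral_distr)
  finally show "(LINT x|lborel. g (c *\<^sub>R x)) = (LINT x|lborel. g x) / c ^ DIM('a)"
    using assms by simp
qed

text \<open>
  This is the reverse triangle inequality in \<open>L\<^sup>p\<close> for \<open>f\<close> and its dilate, raised to the power \<open>p\<close>.
  Writing \<open>f x = f (c x) + (f x - f (c x))\<close>, the weight \<open>1 - t\<close> in the convexity bound is taken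
  to be the ratio \<open>s = c powr (-n/p)\<close> of the two norms. Then the term of the dilate, with its
  factor \<open>s powr (1 - p)\<close>, contributes exactly \<open>s\<close> times the integral of \<open>|f|\<^sup>p\<close> and can be
  absorbed on the left.
\<close>

lemma dilation_difference_lower_bound:
  fixes f :: "'a::euclidean_space \<Rightarrow> 'b::real_normed_vector" and c p :: real
  assumes "1 \<le> p" "1 < c"
    and int_f: "integrable lborel (\<lambda>x. norm (f x) powr p)"
    and int_diff: "integrable lborel (\<lambda>x. norm (f (c *\<^sub>R x) - f x) powr p)"
  shows "(1 - c powr (- (DIM('a) / p))) powr p * (LINT x|lborel. norm (f x) powr p)
           \<le> (LINT x|lborel. norm (f (c *\<^sub>R x) - f x) powr p)"
proof -
  define F where "F = (LINT x|lborel. norm (f x) powr p)"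
  define E where "E = (LINT x|lborel. norm (f (c *\<^sub>R x) - f x) powr p)"
  define s where "s = c powr (- (DIM('a) / p))"
  define t where "t = 1 - s"
  have s: "0 < s" "s < 1"
    using assms DIM_positive[where 'a='a] by (auto simp: s_def powr_less_one)
  then have t: "0 < t" "t < 1" by (auto simp: t_def)
  have "s powr p = c powr (- real DIM('a))"
    using assms by (simp add: s_def powr_powr)
  then have s_powr: "s powr p = 1 / c ^ DIM('a)"
    using assms by (simp add: powr_minus powr_realpow divide_inverse)
  have "F \<le> (LINT x|lborel. s powr (1 - p) * norm (f (c *\<^sub>R x)) powr p
                  + t powr (1 - p) * norm (f (c *\<^sub>R x) - f x) powr p)"
    unfolding F_def
  proof (rule integral_mono)
    fix x :: 'a
    show "norm (f x) powr p \<le> s powr (1 - p) * norm (f (c *\<^sub>R x)) powr p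
                  + t powr (1 - p) * norm (f (c *\<^sub>R x) - f x) powr p"
      using norm_add_powr_le[OF assms(1) t, of "f (c *\<^sub>R x)" "f x - f (c *\<^sub>R x)"]
      by (simp add: t_def norm_minus_commute)
  qed (use assms integrable_lborel_dilation[OF _ int_f, of c] in auto)
  also have "\<dots> = s powr (1 - p) * (F / c ^ DIM('a)) + t powr (1 - p) * E"
    using assms integrable_lborel_dilation[OF _ int_f, of c] integral_lborel_dilation[OF _ int_f, of c]
    by (simp add: F_def E_def)
  also have "s powr (1 - p) * (F / c ^ DIM('a)) = s powr (1 - p) * s powr p * F"
    by (simp add: s_powr)
  also have "s powr (1 - p) * s powr p = s"
    using s by (simp flip: powr_add)
  finally have "t * F \<le> t powr (1 - p) * E"
    by (simp add: t_def algebra_simps)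
  then have "t powr (p - 1) * (t * F) \<le> t powr (p - 1) * (t powr (1 - p) * E)"
    by (intro mult_left_mono) auto
  then have "t powr (p - 1) * t powr 1 * F \<le> t powr (p - 1) * t powr (1 - p) * E"
    using t by (simp add: mult.assoc)
  then show ?thesis
    using t unfolding powr_add[symmetric] by (simp add: F_def E_def t_def s_def)
qed

section \<open>Passing to the infinitesimal dilation\<close>

lemma has_vector_derivative_imp_sequence:
  fixes g :: "real \<Rightarrow> 'a::real_normed_vector"
  assumes "(g has_vector_derivative D) (at a)"
  shows "(\<lambda>k. (g (a + inverse (Suc k)) - g a) /\<^sub>R inverse (Suc k)) \<longlonglongrightarrow> D"
proof -
  have "((\<lambda>h. norm (g (a + h) - g a - h *\<^sub>R D) / norm h) \<longlongrightarrow> 0) (at 0)"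
    using assms by (simp add: has_vector_derivative_def has_derivative_at)
  moreover have "filterlim (\<lambda>k. inverse (real (Suc k))) (at 0) sequentially"
    using LIMSEQ_inverse_real_of_nat by (auto simp: filterlim_at)
  ultimately have "(\<lambda>k. norm (g (a + inverse (Suc k)) - g a - inverse (Suc k) *\<^sub>R D)
                      / norm (inverse (real (Suc k)))) \<longlonglongrightarrow> 0"
    by (rule filterlim_compose)
  moreover have "norm (g (a + inverse (Suc k)) - g a - inverse (Suc k) *\<^sub>R D)
                      / norm (inverse (real (Suc k)))
      = norm ((g (a + inverse (Suc k)) - g a) /\<^sub>R inverse (Suc k) - D)" for k
  proof -
    have "(g (a + inverse (Suc k)) - g a) /\<^sub>R inverse (Suc k) - D
       = (g (a + inverse (Suc k)) - g a - inverse (Suc k) *\<^sub>R D) /\<^sub>R inverse (Suc k)"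
      by (simp add: scaleR_diff_right)
    then show ?thesis by (simp add: divide_inverse mult.commute)
  qed
  ultimately show ?thesis
    by (simp only: LIM_zero_iff tendsto_norm_zero_iff)
qed

lemma integrable_continuous_bounded_support:
  fixes g :: "'a::euclidean_space \<Rightarrow> real"
  assumes "continuous_on UNIV g" "\<And>x. R < norm x \<Longrightarrow> g x = 0"
  shows "integrable lborel g"
proof -
  have "integrable lborel (\<lambda>x. indicator (cball 0 R) x *\<^sub>R g x)"
    using assms(1) by (intro borel_integrable_compact) (auto intro: continuous_on_subset)
  moreover have "(\<lambda>x. indicator (cball 0 R) x *\<^sub>R g x) = g"
    using assms(2) by (auto simp: indicator_def fun_eq_iff not_le)
  ultimately show ?thesis by simp
qed

text \<open>
  The previous bound is divided by \<open>h powr p\<close> with \<open>c = 1 + h\<close>, and \<open>h\<close> runs through \<open>1/(k + 1)\<close>.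
  The global Lipschitz bound \<open>B\<close> provides the dominating function. Since \<open>c > 1\<close>, the dilate
  \<open>f (c x)\<close> vanishes wherever \<open>norm x > R\<close>, so the same ball serves for every \<open>k\<close>.
\<close>

lemma radial_derivative_lower_bound:
  fixes f :: "'a::euclidean_space \<Rightarrow> 'b::real_normed_vector" and p B R :: real
  assumes p: "1 \<le> p"
    and deriv: "\<And>x. (f has_derivative f' x) (at x)"
    and bound: "\<And>x. onorm (f' x) \<le> B"
    and supp: "\<And>x. R < norm x \<Longrightarrow> f x = 0"
  shows "(DIM('a) / p) powr p * (LINT x|lborel. norm (f x) powr p)
           \<le> (LINT x|lborel. norm (f' x x) powr p)"
proof -
  define h where "h k = inverse (real (Suc k))" for k
  define c where "c k = 1 + h k" for k
  define u where "u k x = norm ((f (c k *\<^sub>R x) - f x) /\<^sub>R h k) powr p" for k x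
  define F where "F = (LINT x|lborel. norm (f x) powr p)"
  have h: "0 < h k" for k by (simp add: h_def)
  have cont: "continuous_on UNIV f"
    using deriv by (meson has_derivative_continuous continuous_at_imp_continuous_on)
  have [continuous_intros]: "continuous_on UNIV (\<lambda>x. f (r *\<^sub>R x))" for r
    by (rule continuous_on_compose2[OF cont]) (auto intro: continuous_intros)
  have zero: "f (c k *\<^sub>R x) = 0" "f x = 0" if "R < norm x" for k x
  proof -
    have "norm x \<le> norm (c k *\<^sub>R x)"
      using mult_right_mono[of 1 "c k" "norm x"] h[of k] by (simp add: c_def)
    with that show "f (c k *\<^sub>R x) = 0" "f x = 0" by (auto intro: supp)
  qed
  have int_f: "integrable lborel (\<lambda>x. norm (f x) powr p)"
    using p supp
    by (intro integrable_continuous_bounded_support[where R = R] continuous_on_powr' continuous_intros cont) auto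
  have int_diff: "integrable lborel (\<lambda>x. norm (f (c k *\<^sub>R x) - f x) powr p)" for k
    using p zero
    by (intro integrable_continuous_bounded_support[where R = R] continuous_on_powr' continuous_intros cont) auto
  have u_eq: "u k x = norm (f (c k *\<^sub>R x) - f x) powr p / h k powr p" for k x
    using h[of k] by (simp add: u_def powr_mult powr_divide divide_inverse mult.commute inverse_powr)
  have int_u: "integrable lborel (u k)" for k
    using int_diff[of k] unfolding u_eq by simp
  have u_lim: "(\<lambda>k. u k x) \<longlonglongrightarrow> norm (f' x x) powr p" for x
  proof -
    have "((\<lambda>r. f (r *\<^sub>R x)) has_derivative (\<lambda>r. f' x (r *\<^sub>R x))) (at 1)"
      by (rule has_derivative_compose[where g = f, of _ "\<lambda>r. r *\<^sub>R x"])
         (use deriv in \<open>auto intro!: derivative_eq_intros\<close>)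
    then have "((\<lambda>r. f (r *\<^sub>R x)) has_vector_derivative f' x x) (at 1)"
      using linear_cmul[OF has_derivative_linear[OF deriv]] by (simp add: has_vector_derivative_def)
    from has_vector_derivative_imp_sequence[OF this]
    have "(\<lambda>k. (f (c k *\<^sub>R x) - f x) /\<^sub>R h k) \<longlonglongrightarrow> f' x x"
      by (simp add: c_def h_def)
    then show ?thesis
      unfolding u_def using p by (intro tendsto_powr2 tendsto_norm) auto
  qed
  define w where "w x = indicator (cball 0 R) x *\<^sub>R ((B * norm x) powr p)" for x :: 'a
  have B: "0 \<le> B"
    using onorm_pos_le[OF has_derivative_bounded_linear[OF deriv]] bound order_trans by blast
  have u_le: "norm (u k x) \<le> w x" for k x
  proof (cases "norm x \<le> R")
    case True
    have "norm (f (c k *\<^sub>R x) - f x) \<le> B * norm (c k *\<^sub>R x - x)"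
      by (rule differentiable_bound[of UNIV f f']) (use deriv bound in auto)
    also have "c k *\<^sub>R x - x = h k *\<^sub>R x" by (simp add: c_def algebra_simps)
    finally have "norm ((f (c k *\<^sub>R x) - f x) /\<^sub>R h k) \<le> B * norm x"
      using h[of k] by (simp add: divide_inverse_commute[symmetric] pos_divide_le_eq mult_ac)
    then have "u k x \<le> (B * norm x) powr p"
      unfolding u_def using p by (intro powr_mono2) auto
    with True show ?thesis by (simp add: w_def u_def)
  next
    case False
    then show ?thesis using zero by (simp add: u_def w_def)
  qed
  have int_w: "integrable lborel w"
    unfolding w_def using p
    by (intro borel_integrable_compact continuous_on_powr' continuous_intros) (auto simp: B)
  \<comment> \<open>\<open>f'\<close> need not be continuous; the radial derivative is measurable as a limit of the quotients.\<close>
  have meas: "(\<lambda>x. norm (f' x x) powr p) \<in> borel_measurable lborel"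
    by (rule borel_measurable_LIMSEQ_metric[of u]) (use int_u u_lim in auto)
  have right: "(\<lambda>k. LINT x|lborel. u k x) \<longlonglongrightarrow> (LINT x|lborel. norm (f' x x) powr p)"
    by (rule integral_dominated_convergence[OF meas _ int_w]) (use int_u u_lim u_le in auto)
  define e where "e k = ((1 - c k powr (- (DIM('a) / p))) / h k) powr p" for k
  have "((\<lambda>r. 1 - r powr (- (DIM('a) / p))) has_real_derivative DIM('a) / p) (at 1)"
    by (auto intro!: derivative_eq_intros)
  from has_vector_derivative_imp_sequence[OF this[unfolded has_real_derivative_iff_has_vector_derivative]]
  have "(\<lambda>k. (1 - c k powr (- (DIM('a) / p))) / h k) \<longlonglongrightarrow> DIM('a) / p"
    by (simp add: c_def h_def divide_inverse mult.commute)
  moreover have c_powr: "c k powr (- (DIM('a) / p)) \<le> 1" for k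
    using powr_mono[of "- (DIM('a) / p)" 0 "c k"] p h[of k] by (simp add: c_def)
  ultimately have "e \<longlonglongrightarrow> (DIM('a) / p) powr p"
    unfolding e_def using p h by (intro tendsto_powr2) (auto simp: less_imp_le)
  then have left: "(\<lambda>k. e k * F) \<longlonglongrightarrow> (DIM('a) / p) powr p * F"
    by (intro tendsto_intros)
  have "e k * F \<le> (LINT x|lborel. u k x)" for k
  proof -
    have "e k * F = (1 - c k powr (- (DIM('a) / p))) powr p * F / h k powr p"
      using c_powr[of k] h[of k] by (simp add: e_def powr_divide)
    also have "\<dots> \<le> (LINT x|lborel. norm (f (c k *\<^sub>R x) - f x) powr p) / h k powr p"
      using dilation_difference_lower_bound[OF p _ int_f int_diff[of k]] h[of k]
      by (intro divide_right_mono) (auto simp: F_def c_def)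
    also have "\<dots> = (LINT x|lborel. u k x)"
      unfolding u_eq by simp
    finally show ?thesis .
  qed
  then show ?thesis
    unfolding F_def[symmetric] by (intro LIMSEQ_le[OF left right]) auto
qed

section \<open>Coordinates and compact support\<close>

lemma partial_deriv_has_derivative:
  assumes "(f has_derivative f') (at x)"
  shows "partial_deriv j f x = f' (axis j 1)"
proof -
  have "((\<lambda>t. f (x + t *\<^sub>R axis j 1)) has_derivative (\<lambda>t. f' (t *\<^sub>R axis j 1))) (at 0)"
    by (rule has_derivative_compose[where g = f, of _ "\<lambda>t. t *\<^sub>R axis j 1"])
       (use assms in \<open>auto intro!: derivative_eq_intros\<close>)
  then have "((\<lambda>t. f (x + t *\<^sub>R axis j 1)) has_vector_derivative f' (axis j 1)) (at 0)"
    using linear_cmul[OF has_derivative_linear[OF assms]] by (simp add: has_vector_derivative_def)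
  then show ?thesis
    unfolding partial_deriv_def by (rule vector_derivative_at)
qed

lemma has_derivative_eq_sum_partial_deriv:
  fixes f :: "real ^ 'n::finite \<Rightarrow> complex"
  assumes "(f has_derivative f') (at x)"
  shows "f' v = (\<Sum>j\<in>UNIV. of_real (v $ j) * partial_deriv j f x)"
proof -
  have lin: "linear f'" using assms by (rule has_derivative_linear)
  have "f' v = f' (\<Sum>j\<in>UNIV. (v $ j) *\<^sub>R axis j 1)"
    using basis_expansion[of v] by (simp add: scalar_mult_eq_scaleR)
  also have "\<dots> = (\<Sum>j\<in>UNIV. (v $ j) *\<^sub>R f' (axis j 1))"
    by (simp add: linear_sum[OF lin] linear_cmul[OF lin])
  finally show ?thesis
    using assms by (simp add: partial_deriv_has_derivative scaleR_conv_of_real)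
qed

text \<open>
  The partial derivatives control the operator norm, and they are bounded on the compact ball of
  radius \<open>R\<close>. Outside the ball \<open>f\<close> vanishes in a neighbourhood of each point, so its derivative
  is zero there.
\<close>

lemma bounded_support_derivative_bound:
  fixes f :: "real ^ 'n::finite \<Rightarrow> complex"
  assumes deriv: "\<And>x. (f has_derivative f' x) (at x)"
    and cont: "\<And>j. continuous_on UNIV (partial_deriv j f)"
    and supp: "\<And>x. R < norm x \<Longrightarrow> f x = 0"
  obtains B where "\<And>x. onorm (f' x) \<le> B"
proof -
  define G where "G x = (\<Sum>j\<in>UNIV. cmod (partial_deriv j f x))" for x
  have le_G: "onorm (f' x) \<le> G x" for x
  proof (rule onorm_le)
    fix v
    have "cmod (f' x v) \<le> (\<Sum>j\<in>UNIV. norm v * cmod (partial_deriv j f x))"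
      unfolding has_derivative_eq_sum_partial_deriv[OF deriv]
      by (intro sum_norm_le) (auto simp: norm_mult intro: mult_right_mono component_le_norm_cart)
    then show "cmod (f' x v) \<le> G x * norm v"
      by (simp add: G_def sum_distrib_left sum_distrib_right mult.commute)
  qed
  have "compact (G ` cball 0 R)"
    unfolding G_def using cont
    by (intro compact_continuous_image continuous_intros) (auto intro: continuous_on_subset)
  then obtain C where "\<And>y. y \<in> G ` cball 0 R \<Longrightarrow> norm y \<le> C"
    using compact_imp_bounded bounded_iff by metis
  then have C: "G x \<le> C" if "norm x \<le> R" for x
    using that by (fastforce simp: abs_le_iff)
  have "onorm (f' x) \<le> max C 0" for x
  proof (cases "norm x \<le> R")
    case True
    then show ?thesis using le_G[of x] C[of x] by simp
  next
    case False
    have "((\<lambda>_. 0) has_derivative f' x) (at x)"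
      by (rule has_derivative_transform_within_open[OF deriv, of "- cball 0 R"])
         (use False supp in auto)
    then have "f' x = (\<lambda>_. 0)"
      using has_derivative_unique has_derivative_const by blast
    then show ?thesis by (simp add: onorm_zero)
  qed
  then show ?thesis by (rule that)
qed

theorem theorem1:
  fixes f :: "real ^ 'n::finite \<Rightarrow> complex" and p :: real
  assumes "1 \<le> p"
    and "f \<in> smooth_compact_support"
  shows "(LINT x|lborel. cmod (x_dot_grad f x) powr p)
           \<ge> (real CARD('n) / p) powr p * (LINT x|lborel. cmod (f x) powr p)"
proof -
  have "Ck_function (Suc 0) f" and "compact (closure (support_on UNIV f))"
    using assms(2) unfolding smooth_compact_support_def by blast+
  then have diff: "\<And>x. f differentiable (at x)"
    and cont: "\<And>j. continuous_on UNIV (partial_deriv j f)"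
    and "bounded (closure (support_on UNIV f))"
    by (auto dest: compact_imp_bounded)
  then obtain R where R: "\<And>x. x \<in> support_on UNIV f \<Longrightarrow> norm x \<le> R"
    by (metis bounded_iff closure_subset subsetD)
  have supp: "f x = 0" if "R < norm x" for x
    using R[of x] that by (auto simp: support_on_def)
  obtain f' where f': "\<And>x. (f has_derivative f' x) (at x)"
    using diff unfolding differentiable_def by metis
  obtain B where B: "\<And>x. onorm (f' x) \<le> B"
    using bounded_support_derivative_bound[OF f' cont supp] by blast
  have "f' x x = x_dot_grad f x" for x
    unfolding x_dot_grad_def by (rule has_derivative_eq_sum_partial_deriv[OF f'])
  then show ?thesis
    using radial_derivative_lower_bound[OF assms(1) f' B supp] by simp
qed

end
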